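(* Let $X$ be a real Hausdorff locally convex topological vector space, let $F\subset X$ be a convex set with $0\in\operatorname{int}(F)$, and let $\Omega$ be a nonempty convex subset of $X$. Set $C^*:=\{x^*\in X^*\mid \sigma_F(-x^* )\le 1\}$. Then for any $\bar x\in\Omega$ we have $$\partial\mathcal{T}^F_{\Omega}(\bar x)=N(\bar x;\Omega)\cap C^*.$$ Furthermore, $$\partial\mathcal{T}^F_{\Omega}(\bar x)=N\big(\bar x;\mathrm{cl}_F(\Omega)\big)\cap C^*=N(\bar x;\Omega)\cap C^*.$$
   Context: $X^*$ is the topological dual of $X$, with pairing $\langle x^*,x\rangle=x^*(x)$. The minimal time function with target $\Omega$ and dynamics $F$ is $\mathcal{T}_{\Omega}^F(x):=\inf\{t>0\mid (x+tF)\cap\Omega\neq\emptyset\}$, $x\in X$ (it is real-valued when $0\in\operatorname{int}(F)$ and $\Omega\ne\emptyset$). The $F$-closure of $\Omega$ is $\mathrm{cl}_F(\Omega):=\bigcap_{\varepsilon>0}(\Omega-\varepsilon F)$. The support function of $F$ is $\sigma_F(x^* ):=\sup\{\langle x^*,f\rangle\mid f\in F\}\in(-\infty,\infty]$. For a convex set $A\subset X$ and $\bar x\in A$, the normal cone is $N(\bar x;A):=\{x^*\in X^*\mid \langle x^*,x-\bar x\rangle\le 0\text{ for all }x\in A\}$. For a convex function $\varphi:X\to(-\infty,\infty]$ and $\bar x$ with $\varphi(\bar x)<\infty$, $\partial\varphi(\bar x):=\{x^*\in X^*\mid\langle x^*,x-\bar x\rangle\le\varphi(x)-\varphi(\bar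 x)\text{ for all }x\in X\}$. *)

theory Defs
  imports "HOL-Analysis.Analysis"
begin

text \<open>
  The library has no class of topological vector spaces. Addition and negation are continuous by
  \<^class>\<open>topological_ab_group_add\<close>; joint continuity of scalar multiplication is stated in
  the same filter style as the continuity of addition there.
\<close>

class hausdorff_tvs = real_vector + t2_space + topological_ab_group_add +
  assumes tendsto_scaleR_Pair_tvs:
    "LIM p (nhds (r::real) \<times>\<^sub>F nhds a). fst p *\<^sub>R snd p :> nhds (r *\<^sub>R a)"

instance real_normed_vector \<subseteq> hausdorff_tvs
proof
  fix r :: real and a :: 'a
  have "((\<lambda>p::real \<times> 'a. fst p) \<longlongrightarrow> r) (nhds r \<times>\<^sub>F nhds a)"
    and "((\<lambda>p::real \<times> 'a. snd p) \<longlongrightarrow> a) (nhds r \<times>\<^sub>F nhds a)"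
    by (rule filterlim_fst filterlim_snd)+
  then show "LIM p (nhds r \<times>\<^sub>F nhds a). fst p *\<^sub>R snd p :> nhds (r *\<^sub>R a)"
    by (rule tendsto_scaleR)
qed

definition topological_dual :: "('a::{real_vector,topological_space} \<Rightarrow> real) set" where
  "topological_dual = {x'. linear x' \<and> continuous_on UNIV x'}"

text \<open>
  The infimum is taken in \<^typ>\<open>ereal\<close>, where the infimum of the empty set is \<open>\<infinity>\<close>; on
  \<^typ>\<open>real\<close> it would be an unspecified number.
\<close>

definition minimal_time :: "'a::real_vector set \<Rightarrow> 'a set \<Rightarrow> 'a \<Rightarrow> ereal" where
  "minimal_time F \<Omega> x = Inf {ereal t | t. t > 0 \<and> (\<lambda>f. x + t *\<^sub>R f) ` F \<inter> \<Omega> \<noteq> {}}"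

definition F_closure :: "'a::real_vector set \<Rightarrow> 'a set \<Rightarrow> 'a set" where
  "F_closure F \<Omega> = (\<Inter>\<epsilon>\<in>{0::real<..}. {w - \<epsilon> *\<^sub>R f | w f. w \<in> \<Omega> \<and> f \<in> F})"

definition support_function :: "'a set \<Rightarrow> ('a \<Rightarrow> real) \<Rightarrow> ereal" where
  "support_function F x' = (SUP f\<in>F. ereal (x' f))"

definition normal_cone :: "'a::{real_vector,topological_space} \<Rightarrow> 'a set \<Rightarrow> ('a \<Rightarrow> real) set" where
  "normal_cone xb A = {x' \<in> topological_dual. \<forall>x\<in>A. x' (x - xb) \<le> 0}"

text \<open>Meaningful only at points \<open>xb\<close> where \<open>\<phi> xb\<close> is finite.\<close>

definition subdifferential ::
  "('a::{real_vector,topological_space} \<Rightarrow> ereal) \<Rightarrow> 'a \<Rightarrow> ('a \<Rightarrow> real) set" where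
  "subdifferential \<phi> xb =
     {x' \<in> topological_dual. \<forall>x. ereal (x' (x - xb)) \<le> \<phi> x - \<phi> xb}"

definition C_star :: "'a::{real_vector,topological_space} set \<Rightarrow> ('a \<Rightarrow> real) set" where
  "C_star F = {x' \<in> topological_dual. support_function F (\<lambda>x. - x' x) \<le> 1}"

end

theory Submission
  imports Defs
begin

text \<open>Since 0 lies in \<open>F\<close>, the minimal time vanishes on \<open>\<Omega>\<close>,
  so a subgradient at \<open>xb\<close> is an \<open>x'\<close> in the dual with x'(x - xb) \<le>
  T(x) for all x. Testing this on \<open>\<Omega>\<close> gives normality; testing it at xb - f,
  from where \<open>xb\<close> is reached in time 1, gives -x'(f) \<le> 1. Conversely, if x + t f
  lies in \<open>\<Omega>\<close>, the two conditions together force x'(x - xb) \<le> t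
  (\<open>normal_cone_C_star_shift_le\<close>). The infimum over t yields the subgradient
  inequality; letting t tend to 0 extends normality from \<open>\<Omega>\<close> to its
  \<open>F\<close>-closure.\<close>

lemma minimal_time_nonneg: "0 \<le> minimal_time F \<Omega> x"
  unfolding minimal_time_def by (intro Inf_greatest) auto

lemma minimal_time_le:
  assumes "t > 0" "f \<in> F" "x + t *\<^sub>R f \<in> \<Omega>"
  shows "minimal_time F \<Omega> x \<le> ereal t"
  unfolding minimal_time_def using assms by (intro Inf_lower) blast

text \<open>Staying put (f = 0) makes every t > 0 admissible, so the infimum is 0 although t = 0
  itself is excluded.\<close>

lemma minimal_time_eq_0:
  assumes "0 \<in> F" "x \<in> \<Omega>"
  shows "minimal_time F \<Omega> x = 0"
proof (rule antisym)
  show "minimal_time F \<Omega> x \<le> 0"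
  proof (rule ereal_le_epsilon2)
    show "minimal_time F \<Omega> x \<le> 0 + ereal e" if "0 < e" for e :: real
      using minimal_time_le[OF that assms(1)] assms(2) by simp
  qed
qed (rule minimal_time_nonneg)

lemma subset_F_closure:
  assumes "0 \<in> F"
  shows "\<Omega> \<subseteq> F_closure F \<Omega>"
proof
  fix x assume "x \<in> \<Omega>"
  then have "\<exists>w f. x = w - e *\<^sub>R f \<and> w \<in> \<Omega> \<and> f \<in> F" for e :: real
    using assms by (intro exI[of _ x] exI[of _ 0]) simp
  then show "x \<in> F_closure F \<Omega>"
    unfolding F_closure_def by blast
qed

lemma C_star_iff:
  "x' \<in> C_star F \<longleftrightarrow> x' \<in> topological_dual \<and> (\<forall>f\<in>F. - x' f \<le> 1)"
  by (simp add: C_star_def support_function_def SUP_le_iff)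

lemma normal_cone_antimono: "A \<subseteq> B \<Longrightarrow> normal_cone x B \<subseteq> normal_cone x A"
  unfolding normal_cone_def by blast

text \<open>Split x'(x - xb) as x'(x + t f - xb) + t (-x'(f)): normality bounds the first term by 0,
  membership in \<open>C_star F\<close> bounds the second by t. Both nontrivial inclusions below
  rest on this estimate.\<close>

lemma normal_cone_C_star_shift_le:
  assumes "x' \<in> normal_cone xb \<Omega> \<inter> C_star F" "t \<ge> 0" "f \<in> F" "x + t *\<^sub>R f \<in> \<Omega>"
  shows "x' (x - xb) \<le> t"
proof -
  have "linear x'" and f: "- x' f \<le> 1" and le: "x' (x + t *\<^sub>R f - xb) \<le> 0"
    using assms by (auto simp: normal_cone_def C_star_iff topological_dual_def)
  then have "x' (x + t *\<^sub>R f - xb) = x' (x - xb) + t * x' f"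
    by (simp add: linear_add linear_diff linear_cmul)
  moreover have "t * (- x' f) \<le> t"
    using mult_left_mono[OF f \<open>t \<ge> 0\<close>] by simp
  ultimately show ?thesis
    using le by simp
qed

lemma subdifferential_minimal_time:
  assumes "0 \<in> F" "xb \<in> \<Omega>"
  shows "subdifferential (minimal_time F \<Omega>) xb = normal_cone xb \<Omega> \<inter> C_star F"
proof (intro equalityI subsetI)
  fix x' assume "x' \<in> subdifferential (minimal_time F \<Omega>) xb"
  then have dual: "x' \<in> topological_dual"
    and sub: "ereal (x' (x - xb)) \<le> minimal_time F \<Omega> x" for x
    using minimal_time_eq_0[OF assms] by (auto simp: subdifferential_def)
  have "x' (x - xb) \<le> 0" if "x \<in> \<Omega>" for x
    using sub[of x] minimal_time_eq_0[OF assms(1) that] by simp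
  moreover have "- x' f \<le> 1" if "f \<in> F" for f
  proof -
    \<comment> \<open>The test point xb - f moves to \<open>xb\<close> along f in time exactly
      1.\<close>
    have "minimal_time F \<Omega> (xb - f) \<le> ereal 1"
      using assms(2) that by (intro minimal_time_le) auto
    then have "ereal (x' (xb - f - xb)) \<le> ereal 1"
      by (rule order_trans[OF sub])
    then show ?thesis
      using dual by (simp add: topological_dual_def linear_neg)
  qed
  ultimately show "x' \<in> normal_cone xb \<Omega> \<inter> C_star F"
    using dual by (simp add: normal_cone_def C_star_iff)
next
  fix x' assume x': "x' \<in> normal_cone xb \<Omega> \<inter> C_star F"
  \<comment> \<open>Every admissible time t is an upper bound for the left side, hence so is the
    infimum; if no t is admissible, it is \<infinity>.\<close>
  have "ereal (x' (x - xb)) \<le> minimal_time F \<Omega> x" for x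
    unfolding minimal_time_def
    by (rule Inf_greatest) (auto intro: normal_cone_C_star_shift_le[OF x' less_imp_le])
  then show "x' \<in> subdifferential (minimal_time F \<Omega>) xb"
    using x' minimal_time_eq_0[OF assms] by (simp add: subdifferential_def normal_cone_def)
qed

text \<open>Enlarging the set shrinks the normal cone, which gives one inclusion. For the other, a
  point of the \<open>F\<close>-closure reaches \<open>\<Omega>\<close> within every time e > 0, so
  the shift estimate bounds x'(x - xb) by every such e.\<close>

lemma normal_cone_F_closure:
  assumes "0 \<in> F"
  shows "normal_cone xb (F_closure F \<Omega>) \<inter> C_star F = normal_cone xb \<Omega> \<inter> C_star F"
proof
  show "normal_cone xb (F_closure F \<Omega>) \<inter> C_star F \<subseteq> normal_cone xb \<Omega> \<inter> C_star F"
    using normal_cone_antimono[OF subset_F_closure[OF assms]] by blast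
  show "normal_cone xb \<Omega> \<inter> C_star F \<subseteq> normal_cone xb (F_closure F \<Omega>) \<inter> C_star F"
  proof
    fix x' assume x': "x' \<in> normal_cone xb \<Omega> \<inter> C_star F"
    have "x' (x - xb) \<le> 0" if "x \<in> F_closure F \<Omega>" for x
    proof (rule field_le_epsilon)
      fix e :: real assume "0 < e"
      with that obtain w f where "x = w - e *\<^sub>R f" "w \<in> \<Omega>" "f \<in> F"
        unfolding F_closure_def by blast
      then show "x' (x - xb) \<le> 0 + e"
        using normal_cone_C_star_shift_le[OF x', of e f x] \<open>0 < e\<close> by simp
    qed
    then show "x' \<in> normal_cone xb (F_closure F \<Omega>) \<inter> C_star F"
      using x' by (simp add: normal_cone_def)
  qed
qed

theorem theorem4p1:
  fixes F \<Omega> :: "'a::hausdorff_tvs set" and xb :: 'a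
  assumes "locally convex (UNIV :: 'a set)"
    and "convex F" and "0 \<in> interior F"
    and "convex \<Omega>" and "\<Omega> \<noteq> {}"
    and "xb \<in> \<Omega>"
  shows "subdifferential (minimal_time F \<Omega>) xb = normal_cone xb \<Omega> \<inter> C_star F
    \<and> subdifferential (minimal_time F \<Omega>) xb = normal_cone xb (F_closure F \<Omega>) \<inter> C_star F
    \<and> normal_cone xb (F_closure F \<Omega>) \<inter> C_star F = normal_cone xb \<Omega> \<inter> C_star F"
proof -
  have "0 \<in> F"
    using assms(3) interior_subset by blast
  then show ?thesis
    using assms(6) by (simp add: subdifferential_minimal_time normal_cone_F_closure)
qed

end
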